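(* For each fixed $n \in \mathbb{N}$, the function $F_n(t) = \sum_{p \le n} v_p(n!)\, e^{i p t}$ (sum over all primes $p \le n$) belongs to $L^2([-\pi,\pi])$ and \[ \|F_n\|_{L^2}^2 = 2\pi \sum_{p \le n} v_p(n!)^2 , \] where the sum on the right runs over all primes $p \le n$.
   Context: $\mathbb{N}$ denotes the positive integers. For a prime $p$, $v_p(n!) = \sum_{k \ge 1} \lfloor n/p^k \rfloor$ is the $p$-adic valuation of $n!$. For $n \in \mathbb{N}$, the function $F_n : \mathbb{R} \to \mathbb{C}$ is defined by $F_n(t) = \sum_{p \le n} v_p(n!)\, e^{i p t}$, the sum being over primes $p \le n$. The $L^2$ norm on $[-\pi,\pi]$ is taken with respect to (unnormalized) Lebesgue measure: $\|f\|_{L^2}^2 = \int_{-\pi}^{\pi} |f(t)|^2\, dt$. *)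

theory Defs
  imports "HOL-Analysis.Analysis" "HOL-Computational_Algebra.Primes"
begin

(* Square-integrable functions; elements are functions rather than classes modulo
   almost-everywhere equality. *)

definition L2_space :: "'a measure \<Rightarrow> ('a \<Rightarrow> complex) set" where
  "L2_space M = {f \<in> borel_measurable M. integrable M (\<lambda>x. (cmod (f x))\<^sup>2)}"

definition L2_norm :: "'a measure \<Rightarrow> ('a \<Rightarrow> complex) \<Rightarrow> real" where
  "L2_norm M f = sqrt (\<integral>x. (cmod (f x))\<^sup>2 \<partial>M)"

definition primes_upto :: "nat \<Rightarrow> nat set" where
  "primes_upto n = {p. prime p \<and> p \<le> n}"

definition vp_fact :: "nat \<Rightarrow> nat \<Rightarrow> nat" where
  "vp_fact p n = multiplicity p (fact n :: nat)"

definition F :: "nat \<Rightarrow> real \<Rightarrow> complex" where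
  "F n t = (\<Sum>p\<in>primes_upto n. of_nat (vp_fact p n) * exp (\<i> * of_nat p * of_real t))"

end

theory Submission
  imports Defs
begin

text \<open>This is Parseval's identity for a trigonometric polynomial. \<open>F n\<close> is a
  finite combination of exponentials with distinct integer frequencies, which are pairwise
  orthogonal on [-pi, pi] and have squared norm 2 pi (\<open>has_integral_exp_ii_int\<close>).
  Expanding |F n|^2 as a double sum and integrating termwise leaves only the diagonal
  (\<open>has_integral_cmod_trig_polynomial\<close>). Membership in L^2 follows from continuity on a
  compact interval.\<close>

lemma has_integral_exp_ii_int:
  fixes k :: int
  shows "((\<lambda>t. exp (\<i> * of_int k * of_real t)) has_integral (if k = 0 then 2 * of_real pi else 0)) {-pi..pi}"
proof (cases "k = 0")
  case True
  then show ?thesis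
    using has_integral_const_real [of "1 :: complex" "-pi" pi] by (simp add: scaleR_conv_of_real)
next
  case False
  \<comment> \<open>An antiderivative, available since \<open>k\<close> is nonzero; its 2
    pi-periodicity makes the boundary terms cancel.\<close>
  define G where "G t = exp (\<i> * of_int k * of_real t) / (\<i> * of_int k)" for t :: real
  have "(G has_vector_derivative exp (\<i> * of_int k * of_real t)) (at t within {-pi..pi})" for t
  proof -
    have "((\<lambda>z. exp (\<i> * of_int k * z) / (\<i> * of_int k)) has_field_derivative
        exp (\<i> * of_int k * of_real t)) (at (of_real t))"
      using False by (auto intro!: derivative_eq_intros)
    then show ?thesis
      unfolding G_def by (rule has_vector_derivative_real_field)
  qed
  then have "((\<lambda>t. exp (\<i> * of_int k * of_real t)) has_integral (G pi - G (-pi))) {-pi..pi}"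
    by (intro fundamental_theorem_of_calculus) auto
  moreover have "G pi = G (-pi)"
  proof -
    have "exp (\<i> * of_int k * of_real pi) =
        exp (\<i> * of_int k * of_real (-pi) + \<i> * (of_int k * (of_real pi * 2)))"
      by (simp add: algebra_simps)
    also have "\<dots> = exp (\<i> * of_int k * of_real (-pi))"
      by (rule exp_plus_2pin)
    finally show ?thesis
      by (simp add: G_def)
  qed
  ultimately show ?thesis
    using False by simp
qed

text \<open>Write |f|^2 as f times its conjugate: the term (p, q) has frequency p - q, so its
  integral vanishes unless p = q.\<close>

lemma has_integral_cmod_trig_polynomial:
  fixes c :: "nat \<Rightarrow> complex"
  assumes "finite A"
  shows "((\<lambda>t. (cmod (\<Sum>p\<in>A. c p * exp (\<i> * of_nat p * of_real t)))\<^sup>2) has_integral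
           2 * pi * (\<Sum>p\<in>A. (cmod (c p))\<^sup>2)) {-pi..pi}"
proof -
  define f where "f t = (\<Sum>p\<in>A. c p * exp (\<i> * of_nat p * of_real t))" for t :: real
  \<comment> \<open>The difference is taken in \<open>int\<close>, since subtraction on
    \<open>nat\<close> would truncate it when p < q.\<close>
  have expand: "of_real ((cmod (f t))\<^sup>2) =
      (\<Sum>p\<in>A. \<Sum>q\<in>A. c p * cnj (c q) * exp (\<i> * of_int (int p - int q) * of_real t))" for t
    unfolding complex_norm_square f_def cnj_sum sum_product
    by (intro sum.cong refl) (simp add: exp_cnj exp_diff exp_minus algebra_simps divide_inverse)
  have "((\<lambda>t. complex_of_real ((cmod (f t))\<^sup>2)) has_integral
      (\<Sum>p\<in>A. \<Sum>q\<in>A. c p * cnj (c q) * (if int p - int q = 0 then 2 * of_real pi else 0))) {-pi..pi}"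
    unfolding expand
    by (intro has_integral_sum assms has_integral_mult_right has_integral_exp_ii_int)
  \<comment> \<open>With the condition in the form \<open>p = q\<close>, simplification can collapse
    the inner sum to its diagonal term.\<close>
  also have "(\<Sum>p\<in>A. \<Sum>q\<in>A. c p * cnj (c q) * (if int p - int q = 0 then 2 * of_real pi else 0)) =
      (\<Sum>p\<in>A. \<Sum>q\<in>A. if p = q then c p * cnj (c p) * (2 * of_real pi) else 0)"
    by (intro sum.cong) auto
  also have "\<dots> = of_real (2 * pi * (\<Sum>p\<in>A. (cmod (c p))\<^sup>2))"
    using assms
    by (simp add: complex_norm_square sum_distrib_left mult_ac del: of_real_power)
  \<comment> \<open>The expansion needed complex values; the bounded linear map \<open>Re\<close>
    carries the result back to the reals.\<close>
  finally have "((Re \<circ> (\<lambda>t. complex_of_real ((cmod (f t))\<^sup>2))) has_integral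
      Re (of_real (2 * pi * (\<Sum>p\<in>A. (cmod (c p))\<^sup>2)))) {-pi..pi}"
    by (rule has_integral_linear [OF _ bounded_linear_Re])
  then show ?thesis
    by (simp only: o_def Re_complex_of_real f_def)
qed

theorem proposition4p2:
  fixes n :: nat
  assumes "n \<ge> 1"
  shows "F n \<in> L2_space (lebesgue_on {-pi..pi}) \<and>
    (L2_norm (lebesgue_on {-pi..pi}) (F n))\<^sup>2
      = 2 * pi * (\<Sum>p\<in>primes_upto n. (real (vp_fact p n))\<^sup>2)"
proof -
  have cont: "continuous_on {-pi..pi} (F n)"
    unfolding F_def by (intro continuous_intros)
  then have meas: "F n \<in> borel_measurable (lebesgue_on {-pi..pi})"
    by (intro continuous_imp_measurable_on_sets_lebesgue) auto
  have int: "integrable (lebesgue_on {-pi..pi}) (\<lambda>t. (cmod (F n t))\<^sup>2)"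
    by (intro continuous_imp_integrable_real continuous_intros cont)
  have "finite (primes_upto n)"
    by (simp add: primes_upto_def)
  from has_integral_cmod_trig_polynomial [OF this, of "\<lambda>p. of_nat (vp_fact p n)"]
  have "integral {-pi..pi} (\<lambda>t. (cmod (F n t))\<^sup>2) =
      2 * pi * (\<Sum>p\<in>primes_upto n. (real (vp_fact p n))\<^sup>2)"
    by (intro integral_unique) (simp add: F_def)
  \<comment> \<open>The value was computed as a gauge integral, whereas \<open>L2_norm\<close> uses
    the Lebesgue integral; integrability makes the two agree.\<close>
  with lebesgue_integral_eq_integral [OF int]
  have "(\<integral>t. (cmod (F n t))\<^sup>2 \<partial>lebesgue_on {-pi..pi}) =
      2 * pi * (\<Sum>p\<in>primes_upto n. (real (vp_fact p n))\<^sup>2)"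
    by simp
  then show ?thesis
    \<comment> \<open>Nonnegativity of the sum lets the square cancel the \<open>sqrt\<close> in
      \<open>L2_norm\<close>.\<close>
    using meas int by (simp add: L2_space_def L2_norm_def sum_nonneg)
qed

end
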